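(* Let $k\geq 1$ be an integer, and for $n\geq 1$ let $a_{n,k}$ be the total number of all vertices at level $k$ in all binary search trees on $n$ vertices, that is, $a_{n,k}=\sum_{p}\#\{v : v \text{ is a vertex of } T(p) \text{ at level } k\}$, where $p$ ranges over all $n!$ permutations of $\{1,\dots,n\}$. Then there exists a rational constant $c_k$ such that $$\lim_{n\rightarrow\infty}\frac{a_{n,k}}{(n+1)!}=c_k.$$
   Context: The binary search tree (also called decreasing binary tree) $T(p)$ of a finite sequence $p=p_1p_2\cdots p_n$ of distinct integers (in particular, of a permutation of $\{1,\dots,n\}$) is the rooted binary tree defined recursively: if $p$ is empty, $T(p)$ is empty; otherwise the root is labeled by the largest entry $m$ of $p$, and writing $p=p'\,m\,p''$, the left subtree of the root is $T(p')$ and the right subtree is $T(p'')$. Each vertex has 0, 1 or 2 children, and each child is designated a left or a right child, even if it is an only child. The map $p\mapsto T(p)$ is a bijection between the permutations of $\{1,\dots,n\}$ and the binary search trees on $n$ vertices. A leaf is a vertex with no children. A vertex $v$ is at level $k$ if the shortest path from $v$ to a leaf among its descendants ($v$ itself included) consists of $k-1$ edges. So leaves are at level 1, and a non-leaf vertex is at level $1+m$, where $m$ is the minimum of the levels of its children. *)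

theory Defs
  imports Complex_Main "HOL-Library.Tree" "HOL-Combinatorics.Multiset_Permutations"
begin

(* Trees are those of HOL-Library.Tree, whose constructor Leaf is the empty tree.
   A leaf in the graph-theoretic sense is Node Leaf x Leaf. *)

(* For a sequence without repetitions, xs = takeWhile (\<lambda>x. x \<noteq> m) xs @ m # tl (dropWhile (\<lambda>x. x \<noteq> m) xs). *)
function decreasing_tree :: "'a::linorder list \<Rightarrow> 'a tree" where
  "decreasing_tree xs =
     (if xs = [] then Leaf
      else let m = Max (set xs) in
        Node (decreasing_tree (takeWhile (\<lambda>x. x \<noteq> m) xs)) m
             (decreasing_tree (tl (dropWhile (\<lambda>x. x \<noteq> m) xs))))"
  by pat_completeness auto
termination
proof (relation "measure length", goal_cases)
  case 1
  show ?case by simp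
next
  case (2 xs m)
  then have "m \<in> set xs" by (simp add: Max_in)
  then have "dropWhile (\<lambda>x. x \<noteq> m) xs \<noteq> []" by auto
  moreover have "length xs = length (takeWhile (\<lambda>x. x \<noteq> m) xs) + length (dropWhile (\<lambda>x. x \<noteq> m) xs)"
    by (metis length_append takeWhile_dropWhile_id)
  ultimately show ?case by simp
next
  case (3 xs m)
  then have "length xs > 0" by simp
  moreover have "length (dropWhile (\<lambda>x. x \<noteq> m) xs) \<le> length xs"
    by (rule length_dropWhile_le)
  ultimately have "length (dropWhile (\<lambda>x. x \<noteq> m) xs) - 1 < length xs" by linarith
  then show ?case by simp
qed

declare decreasing_tree.simps [simp del]

(* descendant_at t d s: a path of d edges leads downwards from the root of t to the
   root of the subtree s. *)
inductive descendant_at :: "'a tree \<Rightarrow> nat \<Rightarrow> 'a tree \<Rightarrow> bool" where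
  here: "descendant_at t 0 t"
| left: "descendant_at l d s \<Longrightarrow> descendant_at (Node l x r) (Suc d) s"
| right: "descendant_at r d s \<Longrightarrow> descendant_at (Node l x r) (Suc d) s"

(* The level of the root of a nonempty tree; meaningless for the empty tree. *)
definition level :: "'a tree \<Rightarrow> nat" where
  "level t = Suc (LEAST d. \<exists>x. descendant_at t d (Node Leaf x Leaf))"

(* A vertex is represented by the nonempty subtree rooted at it. This is faithful only
   if the labels of t are distinct; otherwise equal subtrees would be counted once. *)
definition vertices_at_level :: "nat \<Rightarrow> 'a tree \<Rightarrow> 'a tree set" where
  "vertices_at_level k t = {s \<in> subtrees t. s \<noteq> Leaf \<and> level s = k}"

definition total_at_level :: "nat \<Rightarrow> nat \<Rightarrow> nat" where
  "total_at_level n k =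
     (\<Sum>p\<in>permutations_of_set {1..n}. card (vertices_at_level k (decreasing_tree p)))"

lemma inorder_decreasing_tree: "inorder (decreasing_tree xs) = xs"
proof (induction xs rule: decreasing_tree.induct)
  case (1 xs)
  show ?case
  proof (cases "xs = []")
    case True
    then show ?thesis by (simp add: decreasing_tree.simps)
  next
    case False
    define m where "m = Max (set xs)"
    have "m \<in> set xs" using False by (simp add: m_def Max_in)
    then have ne: "dropWhile (\<lambda>x. x \<noteq> m) xs \<noteq> []" by auto
    then have "hd (dropWhile (\<lambda>x. x \<noteq> m) xs) = m"
      using hd_dropWhile[of "\<lambda>x. x \<noteq> m" xs] by simp
    with ne have "m # tl (dropWhile (\<lambda>x. x \<noteq> m) xs) = dropWhile (\<lambda>x. x \<noteq> m) xs"
      by (metis list.collapse)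
    then have "xs = takeWhile (\<lambda>x. x \<noteq> m) xs @ m # tl (dropWhile (\<lambda>x. x \<noteq> m) xs)"
      by (metis takeWhile_dropWhile_id)
    then show ?thesis
      using 1[OF False m_def] False
      by (subst decreasing_tree.simps) (simp add: Let_def m_def)
  qed
qed

lemma descendant_at_leaf_exists: "t \<noteq> Leaf \<Longrightarrow> \<exists>d x. descendant_at t d (Node Leaf x Leaf)"
proof (induction t)
  case Leaf
  then show ?case by simp
next
  case (Node l x r)
  then show ?case
    by (cases "l = Leaf"; cases "r = Leaf") (blast intro: descendant_at.intros)+
qed

lemma level_leaf: "level (Node Leaf x Leaf) = 1"
  unfolding level_def by (auto intro!: Least_equality descendant_at.here)

lemma descendant_at_Leaf_iff: "descendant_at Leaf d s \<longleftrightarrow> d = 0 \<and> s = Leaf"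
  by (auto elim: descendant_at.cases intro: descendant_at.here)

lemma descendant_at_0_iff: "descendant_at t 0 s \<longleftrightarrow> s = t"
  by (auto elim: descendant_at.cases intro: descendant_at.here)

lemma descendant_at_Node_Suc_iff:
  "descendant_at (Node l x r) (Suc d) s \<longleftrightarrow> descendant_at l d s \<or> descendant_at r d s"
  by (auto elim: descendant_at.cases intro: descendant_at.left descendant_at.right)

lemma level_Node:
  assumes "\<not> (l = Leaf \<and> r = Leaf)"
  shows "level (Node l x r) = Suc (Min (level ` ({l, r} - {Leaf})))"
proof -
  let ?P = "\<lambda>t d. \<exists>y. descendant_at t d (Node Leaf y Leaf)"
  have ex: "\<exists>d. ?P t d" if "t \<noteq> Leaf" for t :: "'a tree"
    using descendant_at_leaf_exists[OF that] .
  have "\<not> ?P (Node l x r) 0"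
    using assms by (auto simp: descendant_at_0_iff)
  moreover obtain d where "?P (Node l x r) d" using ex[of "Node l x r"] by blast
  ultimately have "(LEAST d. ?P (Node l x r) d) = Suc (LEAST d. ?P (Node l x r) (Suc d))"
    by (intro Least_Suc)
  then have step: "(LEAST d. ?P (Node l x r) d) = Suc (LEAST d. ?P l d \<or> ?P r d)"
    by (simp only: descendant_at_Node_Suc_iff ex_disj_distrib)
  have lvl: "level t = Suc (LEAST d. ?P t d)" for t :: "'a tree" by (simp add: level_def)
  have least: "(LEAST d. A d \<or> B d) = min (Least A) (Least B)"
    if "\<exists>d. A d" "\<exists>d. B d" for A B :: "nat \<Rightarrow> bool"
  proof (rule Least_equality)
    show "A (min (Least A) (Least B)) \<or> B (min (Least A) (Least B))"
      using that by (metis LeastI_ex min_def)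
  qed (auto simp: min_le_iff_disj intro: Least_le)
  show ?thesis
  proof (cases "l = Leaf \<or> r = Leaf")
    case True
    then consider "l = Leaf" "r \<noteq> Leaf" | "r = Leaf" "l \<noteq> Leaf" using assms by blast
    then show ?thesis
    proof cases
      case 1
      then have "{l, r} - {Leaf} = {r}" by auto
      with 1 show ?thesis unfolding lvl[of "Node l x r"] step by (simp add: descendant_at_Leaf_iff lvl[of r])
    next
      case 2
      then have "{l, r} - {Leaf} = {l}" by auto
      with 2 show ?thesis unfolding lvl[of "Node l x r"] step by (simp add: descendant_at_Leaf_iff lvl[of l])
    qed
  next
    case False
    then have "{l, r} - {Leaf} = {l, r}" by auto
    then show ?thesis
      using least[OF ex[of l] ex[of r]] False by (simp add: lvl[of "Node l x r"] step lvl[of l] lvl[of r])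
  qed
qed

end

theory Submission
  imports Defs "HOL-Computational_Algebra.Formal_Power_Series"
begin

text \<open>
  In a random binary search tree on \<open>n\<close> vertices the two subtrees of the root are again random
  binary search trees, with \<open>j\<close> and \<open>n - 1 - j\<close> vertices for uniformly distributed \<open>j < n\<close>
  (\<open>sum_decreasing_trees_product\<close>). If \<open>p\<^sub>n\<close> is the probability that the root is at level \<open>k\<close>,
  the expected number \<open>e\<^sub>n = a\<^bsub>n,k\<^esub> / n!\<close> of vertices at level \<open>k\<close> therefore satisfies the
  quicksort recurrence \<open>e\<^sub>n = p\<^sub>n + (2 / n) (e\<^sub>0 + \<dots> + e\<^bsub>n-1\<^esub>)\<close>, whose solution is
  \<open>e\<^sub>n = p\<^sub>n + 2 (n + 1) \<Sum>\<^bsub>i<n\<^esub> p\<^sub>i / ((i + 1) (i + 2))\<close> (\<open>toll_sum_recurrence\<close>,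
  \<open>sum_vertices_at_level\<close>). Dividing by \<open>n + 1\<close> shows that the limit is
  \<open>2 \<Sum>\<^sub>i p\<^sub>i / ((i + 1) (i + 2))\<close>, and what remains is that this series has a rational sum.

  Let \<open>Q\<^sub>k\<close> be the generating function of the probabilities that a tree is empty or has its
  root above level \<open>k\<close>. The root of a tree with at least two vertices is above level \<open>k + 1\<close>
  exactly if each subtree is empty or has its root above level \<open>k\<close>; hence
  \<open>Q\<^bsub>k+1\<^esub>' = Q\<^sub>k\<^sup>2 - 1\<close>, where the \<open>1\<close> removes the tree with one vertex. Starting from
  \<open>Q\<^sub>0 = 1 / u\<close> with \<open>u = 1 - X\<close>, induction shows that \<open>Q\<^sub>k - 1 / u\<close> is a polynomial in \<open>u\<close> and
  \<open>L = log u\<close> with rational coefficients (\<open>deep_gf_diff_geometric\<close>): the pole \<open>1 / u\<close>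
  reproduces itself because \<open>(1 / u)' = 1 / u\<^sup>2\<close>, and both \<open>u\<^sup>a L\<^sup>b\<close> and \<open>L\<^sup>b / u\<close> have
  antiderivatives among these polynomials. So the generating function of \<open>p\<close>, a difference of
  two consecutive \<open>Q\<close>s, is such a polynomial.

  For a rational polynomial \<open>f\<close> in \<open>u\<close> and \<open>L\<close>, the numbers \<open>f\<^sub>i / ((i + 1) (i + 2))\<close> are the
  coefficients from index \<open>2\<close> on of a double antiderivative, which can be chosen as a rational
  polynomial divisible by \<open>u\<close>. The coefficients of the latter add up to its value \<open>0\<close> at
  \<open>X = 1\<close>, so the sum in question is minus its first two coefficients, which are rational
  (\<open>log_polys_weighted_sum_rational\<close>). Working with formal power series keeps this free of
  analysis: the only limits needed are those of coefficient sequences.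
\<close>

unbundle fps_syntax

section \<open>Logarithmic polynomials as formal power series\<close>

definition co_X :: "real fps" where
  "co_X = 1 - fps_X"

definition geometric :: "real fps" where
  "geometric = Abs_fps (\<lambda>_. 1)"

text \<open>
  The Mercator series of \<open>log (1 - X)\<close>. Its constant coefficient is \<open>0\<close> because division by
  zero yields zero.
\<close>

definition log_co_X :: "real fps" where
  "log_co_X = Abs_fps (\<lambda>n. - 1 / real n)"

lemma co_X_mult_geometric: "co_X * geometric = 1"
  by (rule fps_ext) (simp add: co_X_def geometric_def left_diff_distrib)

lemma fps_deriv_co_X: "fps_deriv co_X = -1"
  by (simp add: co_X_def)

lemma fps_deriv_geometric: "fps_deriv geometric = geometric ^ 2"
  by (rule fps_ext) (simp add: geometric_def power2_eq_square fps_mult_nth)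

lemma fps_deriv_log_co_X: "fps_deriv log_co_X = - geometric"
  by (rule fps_ext) (simp add: log_co_X_def geometric_def)

lemma mult_geometric_nth: "(f * geometric) $ n = (\<Sum>i\<le>n. f $ i)"
  by (simp add: fps_mult_nth geometric_def atMost_atLeast0)

lemma fps_deriv_co_X_power_Suc:
  "fps_deriv (co_X ^ Suc a) = fps_const (- real (Suc a)) * co_X ^ a"
  by (simp add: fps_deriv_power fps_deriv_co_X flip: fps_const_neg del: of_nat_Suc power_Suc)

lemma fps_deriv_log_co_X_power_Suc:
  "fps_deriv (log_co_X ^ Suc b) = fps_const (- real (Suc b)) * (geometric * log_co_X ^ b)"
  by (simp add: fps_deriv_power fps_deriv_log_co_X mult.assoc
           flip: fps_const_neg del: of_nat_Suc power_Suc)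

text \<open>
  The rational span of the \<open>u\<^sup>a L\<^sup>b\<close> with \<open>a \<ge> m\<close>, where \<open>u = 1 - X\<close> and \<open>L = log u\<close>. The
  index records the order of vanishing at \<open>X = 1\<close>, which integration raises by one and which
  decides whether the coefficients sum to zero.
\<close>

inductive_set log_polys :: "nat \<Rightarrow> real fps set" for m where
  monom: "c \<in> \<rat> \<Longrightarrow> m \<le> a \<Longrightarrow> fps_const c * (co_X ^ a * log_co_X ^ b) \<in> log_polys m"
| add: "f \<in> log_polys m \<Longrightarrow> g \<in> log_polys m \<Longrightarrow> f + g \<in> log_polys m"

lemma log_polys_const: "c \<in> \<rat> \<Longrightarrow> fps_const c \<in> log_polys 0"
  using log_polys.monom[of c 0 0 0] by simp

lemma log_polys_mono: "f \<in> log_polys m \<Longrightarrow> n \<le> m \<Longrightarrow> f \<in> log_polys n"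
  by (induction rule: log_polys.induct) (auto intro: log_polys.intros)

lemma log_polys_mult:
  assumes "f \<in> log_polys m" "g \<in> log_polys n"
  shows "f * g \<in> log_polys (m + n)"
  using assms(1)
proof induction
  case (monom c a b)
  show ?case using assms(2)
  proof induction
    case (monom d a' b')
    have "fps_const c * (co_X ^ a * log_co_X ^ b) * (fps_const d * (co_X ^ a' * log_co_X ^ b'))
        = fps_const (c * d) * (co_X ^ (a + a') * log_co_X ^ (b + b'))"
      by (simp add: power_add mult_ac flip: fps_const_mult)
    then show ?case
      using monom \<open>c \<in> \<rat>\<close> \<open>m \<le> a\<close>
      by (simp only:) (rule log_polys.monom, auto)
  qed (simp add: distrib_left log_polys.add)
qed (simp add: distrib_right log_polys.add)

lemma log_polys_diff:
  assumes "f \<in> log_polys m" "g \<in> log_polys m"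
  shows "f - g \<in> log_polys m"
proof -
  have "fps_const (-1) * g \<in> log_polys m"
    using log_polys_mult[OF log_polys_const assms(2), of "-1"] by simp
  then have "f + fps_const (-1) * g \<in> log_polys m"
    using assms(1) by (intro log_polys.add)
  then show ?thesis by (simp flip: fps_const_neg)
qed

lemma log_polys_constant_coeff_rational: "f \<in> log_polys m \<Longrightarrow> f $ 0 \<in> \<rat>"
  by (induction rule: log_polys.induct)
     (auto simp: fps_power_zeroth co_X_def log_co_X_def)

lemma log_polys_Suc_factor:
  assumes "f \<in> log_polys (Suc m)"
  shows "\<exists>g \<in> log_polys m. f = co_X * g"
  using assms
proof induction
  case (monom c a b)
  then obtain a' where a: "a = Suc a'" "m \<le> a'" by (cases a) auto
  show ?case
    by (rule bexI[of _ "fps_const c * (co_X ^ a' * log_co_X ^ b)"])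
       (use a monom in \<open>auto intro: log_polys.monom simp: mult_ac\<close>)
next
  case (add f g)
  then show ?case by (metis distrib_left log_polys.add)
qed

text \<open>Integration by parts on the exponent of the logarithm: since \<open>u' = -1\<close> and \<open>u L' = -1\<close>,
  the derivative of \<open>- u\<^bsup>a+1\<^esup> L\<^sup>b / (a + 1)\<close> is \<open>u\<^sup>a L\<^sup>b\<close> plus a multiple of
  \<open>u\<^sup>a L\<^bsup>b-1\<^esup>\<close>. The antiderivative is the one that vanishes at \<open>X = 1\<close>, not at \<open>X = 0\<close>.\<close>

lemma log_polys_antideriv_monom:
  assumes "c \<in> \<rat>" "m \<le> a"
  shows "\<exists>g \<in> log_polys (Suc m). fps_deriv g = fps_const c * (co_X ^ a * log_co_X ^ b)"
  using assms(1)
proof (induction b arbitrary: c)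
  case 0
  have "fps_deriv (fps_const (- c / Suc a) * (co_X ^ Suc a * log_co_X ^ 0))
      = fps_const (- c / Suc a) * fps_const (- real (Suc a)) * co_X ^ a"
    by (simp add: fps_deriv_co_X_power_Suc mult.assoc
             del: of_nat_Suc power_Suc fps_const_mult)
  also have "\<dots> = fps_const c * (co_X ^ a * log_co_X ^ 0)"
    by (simp del: of_nat_Suc)
  finally have "fps_deriv (fps_const (- c / Suc a) * (co_X ^ Suc a * log_co_X ^ 0))
      = fps_const c * (co_X ^ a * log_co_X ^ 0)" .
  moreover have "fps_const (- c / Suc a) * (co_X ^ Suc a * log_co_X ^ 0) \<in> log_polys (Suc m)"
    using assms(2) 0 by (intro log_polys.monom) auto
  ultimately show ?case by blast
next
  case (Suc b)
  let ?d = "- c / Suc a"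
  let ?g = "fps_const ?d * (co_X ^ Suc a * log_co_X ^ Suc b)"
  obtain h where h: "h \<in> log_polys (Suc m)"
    "fps_deriv h = fps_const (- ?d * Suc b) * (co_X ^ a * log_co_X ^ b)"
    using Suc.IH[of "- ?d * Suc b"] Suc.prems by auto
  have "fps_deriv ?g
      = fps_const ?d * fps_const (- real (Suc a)) * (co_X ^ a * log_co_X ^ Suc b)
        + fps_const ?d * fps_const (- real (Suc b)) * ((co_X * geometric) * co_X ^ a * log_co_X ^ b)"
    by (simp only: fps_deriv_mult fps_deriv_const fps_deriv_co_X_power_Suc
          fps_deriv_log_co_X_power_Suc) (simp only: algebra_simps power_Suc mult_zero_left add_0_left)
  also have "\<dots> = fps_const c * (co_X ^ a * log_co_X ^ Suc b) + fps_deriv h"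
    unfolding h co_X_mult_geometric by (simp del: of_nat_Suc)
  finally have "fps_deriv (?g - h) = fps_const c * (co_X ^ a * log_co_X ^ Suc b)"
    by simp
  moreover have "?g \<in> log_polys (Suc m)"
    using Suc.prems assms(2) by (intro log_polys.monom) auto
  ultimately show ?case using h(1) by (blast intro: log_polys_diff)
qed

lemma log_polys_antideriv:
  assumes "f \<in> log_polys m"
  shows "\<exists>g \<in> log_polys (Suc m). fps_deriv g = f"
  using assms
proof induction
  case (add f g)
  then show ?case by (metis fps_deriv_add log_polys.add)
qed (rule log_polys_antideriv_monom)

text \<open>Dividing by \<open>u\<close> lowers the exponent of \<open>u\<close>, which is harmless unless it is already \<open>0\<close>; in
  that case \<open>L\<^sup>b / u\<close> is the derivative of \<open>- L\<^bsup>b+1\<^esup> / (b + 1)\<close>. This is where logarithms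
  enter.\<close>

lemma log_polys_antideriv_geometric:
  assumes "f \<in> log_polys 0"
  shows "\<exists>g \<in> log_polys 0. fps_deriv g = geometric * f"
  using assms
proof induction
  case (monom c a b)
  show ?case
  proof (cases a)
    case 0
    let ?g = "fps_const (- c / Suc b) * (co_X ^ 0 * log_co_X ^ Suc b)"
    have "fps_deriv ?g = fps_const (- c / Suc b) * fps_const (- real (Suc b)) * (geometric * log_co_X ^ b)"
      by (simp add: fps_deriv_log_co_X_power_Suc mult.assoc
               del: of_nat_Suc power_Suc fps_const_mult)
    also have "\<dots> = geometric * (fps_const c * (co_X ^ a * log_co_X ^ b))"
      using 0 by (simp add: mult_ac del: of_nat_Suc)
    finally have "fps_deriv ?g = geometric * (fps_const c * (co_X ^ a * log_co_X ^ b))" .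
    moreover have "?g \<in> log_polys 0"
      using monom by (intro log_polys.monom) auto
    ultimately show ?thesis by blast
  next
    case (Suc a')
    have "geometric * (fps_const c * (co_X ^ a * log_co_X ^ b))
        = co_X * geometric * (fps_const c * (co_X ^ a' * log_co_X ^ b))"
      unfolding Suc by (simp add: mult_ac)
    also have "\<dots> = fps_const c * (co_X ^ a' * log_co_X ^ b)"
      by (simp add: co_X_mult_geometric)
    finally have "geometric * (fps_const c * (co_X ^ a * log_co_X ^ b))
        = fps_const c * (co_X ^ a' * log_co_X ^ b)" .
    then have "geometric * (fps_const c * (co_X ^ a * log_co_X ^ b)) \<in> log_polys 0"
      using monom by (simp only: log_polys.monom le0)
    then show ?thesis using log_polys_antideriv log_polys_mono by blast
  qed
next
  case (add f g)
  then show ?case by (metis distrib_left fps_deriv_add log_polys.add)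
qed

section \<open>Decay of coefficients and rational sums\<close>

lemma cesaro_mean_tendsto_zero:
  fixes x :: "nat \<Rightarrow> real"
  assumes "x \<longlonglongrightarrow> 0"
  shows "(\<lambda>n. (\<Sum>i<n. x i) / n) \<longlonglongrightarrow> 0"
proof (rule LIMSEQ_I)
  fix e :: real assume e: "e > 0"
  obtain N where N: "\<And>n. n \<ge> N \<Longrightarrow> \<bar>x n\<bar> < e / 2"
    using LIMSEQ_D[OF assms, of "e / 2"] e by auto
  define S where "S = (\<Sum>i<N. \<bar>x i\<bar>)"
  obtain M :: nat where M: "M > 2 * S / e" using reals_Archimedean2 by blast
  have "\<bar>(\<Sum>i<n. x i) / n\<bar> < e" if n: "n \<ge> Suc (max N M)" for n
  proof -
    have split: "{..<n} = {..<N} \<union> {N..<n}" using n by auto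
    have "\<bar>\<Sum>i<n. x i\<bar> \<le> (\<Sum>i<n. \<bar>x i\<bar>)" by (rule sum_abs)
    also have "\<dots> = S + (\<Sum>i\<in>{N..<n}. \<bar>x i\<bar>)"
      unfolding S_def split by (rule sum.union_disjoint) auto
    also have "(\<Sum>i\<in>{N..<n}. \<bar>x i\<bar>) \<le> (\<Sum>i\<in>{N..<n}. e / 2)"
      using N by (intro sum_mono less_imp_le) auto
    also have "\<dots> \<le> n * (e / 2)"
      using e by (simp add: mult_right_mono)
    also have "S < n * (e / 2)"
    proof -
      have "2 * S / e < real n" using M n by linarith
      then show ?thesis using e by (simp add: field_simps)
    qed
    finally have "\<bar>\<Sum>i<n. x i\<bar> < n * e" by (simp add: mult.commute)
    then show ?thesis using n by (simp add: field_simps)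
  qed
  then show "\<exists>no. \<forall>n\<ge>no. norm ((\<Sum>i<n. x i) / n - 0) < e" by auto
qed

text \<open>From \<open>(L\<^bsup>b+1\<^esup>)' = - (b + 1) L\<^sup>b / u\<close> and because dividing by \<open>u\<close> forms partial sums, the
  \<open>n\<close>-th coefficient of \<open>L\<^bsup>b+1\<^esup>\<close> is a constant times the mean of the first \<open>n\<close> coefficients
  of \<open>L\<^sup>b\<close>. Hence the decay passes from one power to the next.\<close>

lemma log_power_coeff_tendsto_zero: "(\<lambda>n. (log_co_X ^ b) $ n) \<longlonglongrightarrow> 0"
proof (induction b)
  case 0
  have "eventually (\<lambda>n. (log_co_X ^ 0) $ n = 0) sequentially"
    by (rule eventually_sequentiallyI[of 1]) auto
  then show ?case by (rule tendsto_eventually)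
next
  case (Suc b)
  have coeff: "(log_co_X ^ Suc b) $ n = - real (Suc b) * ((\<Sum>i<n. (log_co_X ^ b) $ i) / n)"
    if "n \<ge> 1" for n
  proof -
    obtain n' where n': "n = Suc n'" using \<open>n \<ge> 1\<close> by (cases n) auto
    have "fps_deriv (log_co_X ^ Suc b) $ n'
        = - real (Suc b) * (log_co_X ^ b * geometric) $ n'"
      by (simp only: fps_deriv_log_co_X_power_Suc fps_mult_left_const_nth mult.commute[of geometric])
    then have "real n * (log_co_X ^ Suc b) $ n = - real (Suc b) * (\<Sum>i<n. (log_co_X ^ b) $ i)"
      unfolding n' by (simp only: mult_geometric_nth fps_deriv_nth lessThan_Suc_atMost
          flip: Suc_eq_plus1)
    then show ?thesis using \<open>n \<ge> 1\<close> by (simp add: field_simps del: of_nat_Suc power_Suc)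
  qed
  have "(\<lambda>n. - real (Suc b) * ((\<Sum>i<n. (log_co_X ^ b) $ i) / n)) \<longlonglongrightarrow> - real (Suc b) * 0"
    by (intro tendsto_mult tendsto_const cesaro_mean_tendsto_zero Suc.IH)
  then show ?case
    unfolding mult_zero_right
    by (rule Lim_transform_eventually) (rule eventually_sequentiallyI[of 1], simp only: coeff)
qed

lemma co_X_mult_coeff_tendsto_zero:
  assumes "(\<lambda>n. f $ n) \<longlonglongrightarrow> 0"
  shows "(\<lambda>n. (co_X * f) $ n) \<longlonglongrightarrow> 0"
proof (rule LIMSEQ_imp_Suc)
  have "(\<lambda>n. f $ Suc n - f $ n) \<longlonglongrightarrow> 0 - 0"
    by (intro tendsto_diff LIMSEQ_Suc assms)
  then show "(\<lambda>n. (co_X * f) $ Suc n) \<longlonglongrightarrow> 0"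
    by (simp add: co_X_def left_diff_distrib)
qed

lemma log_polys_coeff_tendsto_zero:
  assumes "f \<in> log_polys m"
  shows "(\<lambda>n. f $ n) \<longlonglongrightarrow> 0"
  using assms
proof induction
  case (monom c a b)
  have "(\<lambda>n. (co_X ^ a * log_co_X ^ b) $ n) \<longlonglongrightarrow> 0"
    by (induction a)
       (simp_all add: log_power_coeff_tendsto_zero co_X_mult_coeff_tendsto_zero mult.assoc)
  then show ?case using tendsto_mult_right_zero by fastforce
next
  case (add f g)
  then show ?case using tendsto_add by fastforce
qed

text \<open>If \<open>f = (1 - X) g\<close>, the partial sums of the coefficients of \<open>f\<close> are the coefficients of \<open>g\<close>.\<close>

lemma log_polys_coeff_sums_zero:
  assumes "f \<in> log_polys (Suc m)"
  shows "(\<lambda>n. f $ n) sums 0"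
proof -
  obtain g where g: "g \<in> log_polys m" "f = co_X * g"
    using log_polys_Suc_factor[OF assms] by blast
  have partial: "(\<Sum>i<Suc n. f $ i) = g $ n" for n
    by (induction n) (simp_all add: g(2) co_X_def left_diff_distrib)
  show ?thesis
    unfolding sums_def
    by (rule LIMSEQ_imp_Suc) (simp only: partial log_polys_coeff_tendsto_zero[OF g(1)])
qed

text \<open>The weights come from integrating twice: if \<open>h'' = f\<close>, then the coefficient of \<open>h\<close> at
  \<open>n + 2\<close> is that of \<open>f\<close> at \<open>n\<close> divided by \<open>(n + 1) (n + 2)\<close>. For an \<open>h\<close> that vanishes at
  \<open>X = 1\<close> only the two initial coefficients are left over.\<close>

lemma log_polys_weighted_sum_rational:
  assumes "f \<in> log_polys 0"
  shows "\<exists>c\<in>\<rat>. (\<lambda>n. f $ n / (real (n + 1) * real (n + 2))) sums c"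
proof -
  obtain g where g: "g \<in> log_polys 1" "fps_deriv g = f"
    using log_polys_antideriv[OF assms] by auto
  obtain h where h: "h \<in> log_polys 2" "fps_deriv h = g"
    using log_polys_antideriv[OF g(1)] by (auto simp: numeral_2_eq_2)
  have coeff: "h $ (n + 2) = f $ n / (real (n + 1) * real (n + 2))" for n
  proof -
    have "f $ n = real (n + 1) * real (n + 2) * h $ (n + 2)"
      by (simp flip: g(2) h(2) add: mult_ac)
    then show ?thesis by (simp del: of_nat_add)
  qed
  have "(\<lambda>n. h $ n) sums 0"
    using log_polys_coeff_sums_zero h(1) by (simp add: numeral_2_eq_2)
  then have "(\<lambda>n. h $ (n + 2)) sums (0 - (\<Sum>i<2. h $ i))"
    by (rule sums_split_initial_segment)
  then have "(\<lambda>n. f $ n / (real (n + 1) * real (n + 2))) sums (0 - (\<Sum>i<2. h $ i))"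
    by (simp only: coeff)
  moreover have "(\<Sum>i<2. h $ i) = h $ 0 + g $ 0"
    by (simp flip: h(2) add: numeral_2_eq_2)
  ultimately show ?thesis
    using log_polys_constant_coeff_rational[OF g(1)] log_polys_constant_coeff_rational[OF h(1)]
    by (intro bexI[of _ "0 - (h $ 0 + g $ 0)"]) (simp_all only: Rats_diff Rats_add Rats_0)
qed

section \<open>The generating functions of deep trees\<close>

text \<open>The coefficient of \<open>deep_gf k\<close> at \<open>n\<close> is the probability that a random tree on \<open>n\<close> vertices
  is empty or has its root above level \<open>k\<close>; see \<open>sum_deep\<close> below.\<close>

primrec deep_gf :: "nat \<Rightarrow> real fps" where
  "deep_gf 0 = geometric"
| "deep_gf (Suc k) = fps_integral ((deep_gf k)\<^sup>2 - 1) 1"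

text \<open>With \<open>R\<close> for the difference from \<open>1 / u\<close>, the recurrence of the generating functions becomes
  \<open>R\<^bsub>k+1\<^esub>' = 2 R\<^sub>k / u + R\<^sub>k\<^sup>2 - 1\<close>, because the square of \<open>1 / u\<close> cancels against its
  derivative. The right-hand side can be integrated within the span, and the constant of
  integration is rational.\<close>

lemma deep_gf_diff_geometric: "deep_gf k - geometric \<in> log_polys 0"
proof (induction k)
  case 0
  show ?case using log_polys_const[of 0] by simp
next
  case (Suc k)
  define R where "R = deep_gf k - geometric"
  have R: "R \<in> log_polys 0" using Suc by (simp add: R_def)
  have "fps_deriv (deep_gf (Suc k) - geometric) = (geometric + R)\<^sup>2 - 1 - geometric\<^sup>2"
    by (simp add: R_def fps_deriv_fps_integral fps_deriv_geometric)
  also have "\<dots> = geometric * (fps_const 2 * R) + (R * R - fps_const 1)"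
    by (simp add: power2_eq_square algebra_simps flip: numeral_fps_const)
  finally have deriv: "fps_deriv (deep_gf (Suc k) - geometric)
      = geometric * (fps_const 2 * R) + (R * R - fps_const 1)" .
  have "fps_const 2 * R \<in> log_polys 0"
    using log_polys_mult[OF log_polys_const R, of 2] by simp
  then obtain g where g: "g \<in> log_polys 0" "fps_deriv g = geometric * (fps_const 2 * R)"
    using log_polys_antideriv_geometric by blast
  have "R * R - fps_const 1 \<in> log_polys 0"
    using log_polys_mult[OF R R] log_polys_const[of 1] by (intro log_polys_diff) simp_all
  then obtain h where h: "h \<in> log_polys (Suc 0)" "fps_deriv h = R * R - fps_const 1"
    using log_polys_antideriv by blast
  have "fps_deriv (deep_gf (Suc k) - geometric) = fps_deriv (g + h)"
    unfolding deriv fps_deriv_add g(2) h(2) ..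
  then have "deep_gf (Suc k) - geometric
      = fps_const ((deep_gf (Suc k) - geometric) $ 0 - (g + h) $ 0) + (g + h)"
    by (rule iffD1[OF fps_deriv_eq_iff])
  moreover have "(deep_gf (Suc k) - geometric) $ 0 = 0"
    by (simp add: geometric_def)
  moreover have "g + h \<in> log_polys 0"
    using g(1) log_polys_mono[OF h(1)] by (simp add: log_polys.add)
  ultimately show ?case
    by (metis Rats_0 Rats_diff log_polys.add log_polys_const log_polys_constant_coeff_rational)
qed

section \<open>Sums over permutations split at the maximum\<close>

lemma decreasing_tree_split:
  assumes "\<And>x. x \<in> set xs \<union> set ys \<Longrightarrow> x < m"
  shows "decreasing_tree (xs @ m # ys) = Node (decreasing_tree xs) m (decreasing_tree ys)"
proof -
  have "Max (set (xs @ m # ys)) = m"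
    using assms by (intro Max_eqI) (auto simp: less_imp_le)
  moreover have "takeWhile (\<lambda>x. x \<noteq> m) (xs @ m # ys) = xs"
    "tl (dropWhile (\<lambda>x. x \<noteq> m) (xs @ m # ys)) = ys"
    using assms by (auto simp: takeWhile_append dropWhile_append)
  ultimately show ?thesis
    by (subst decreasing_tree.simps) (simp add: Let_def)
qed

lemma set_tree_decreasing_tree: "set_tree (decreasing_tree xs) = set xs"
  by (metis inorder_decreasing_tree set_inorder)

text \<open>A permutation of \<open>A\<close> is determined by the set \<open>B\<close> of the entries before \<open>m\<close>, an arrangement
  of \<open>B\<close> and an arrangement of the remaining entries.\<close>

lemma bij_betw_permutations_split:
  assumes "m \<in> A"
  shows "bij_betw (\<lambda>(B, xs, ys). xs @ m # ys)
    (SIGMA B : Pow (A - {m}). permutations_of_set B \<times> permutations_of_set (A - {m} - B))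
    (permutations_of_set A)"
    (is "bij_betw ?join ?S _")
proof (rule bij_betw_imageI)
  show "inj_on ?join ?S"
  proof (rule inj_onI)
    fix s t assume s: "s \<in> ?S" and t: "t \<in> ?S" and eq: "?join s = ?join t"
    obtain B xs ys C zs ws where st: "s = (B, xs, ys)" "t = (C, zs, ws)"
      by (metis surj_pair)
    have sets: "set xs = B" "set zs = C"
      using s t unfolding st by (auto dest: permutations_of_setD)
    have "m \<notin> set xs" "m \<notin> set ys"
      using s unfolding st by (auto dest: permutations_of_setD)
    moreover have "xs @ m # ys = zs @ m # ws" using eq by (simp add: st)
    ultimately have "xs = zs \<and> ys = ws"
      using append_Cons_eq_iff[of m xs ys zs ws] by blast
    then show "s = t" using sets by (simp add: st)
  qed
  show "?join ` ?S = permutations_of_set A"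
  proof (intro equalityI subsetI)
    fix p assume "p \<in> ?join ` ?S"
    then obtain B xs ys where B: "B \<subseteq> A - {m}" and p: "p = xs @ m # ys"
      and xs: "xs \<in> permutations_of_set B" and ys: "ys \<in> permutations_of_set (A - {m} - B)"
      by auto
    show "p \<in> permutations_of_set A"
      unfolding p using assms B permutations_of_setD[OF xs] permutations_of_setD[OF ys]
      by (intro permutations_of_setI) auto
  next
    fix p assume p: "p \<in> permutations_of_set A"
    then obtain xs ys where split: "p = xs @ m # ys"
      using assms by (metis permutations_of_setD(1) split_list)
    have "set p = A" "distinct p" using permutations_of_setD[OF p] .
    then have "set xs \<subseteq> A - {m}" "set ys = A - {m} - set xs" "distinct xs" "distinct ys"
      unfolding split by auto
    then have "(set xs, xs, ys) \<in> ?S" by auto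
    then show "p \<in> ?join ` ?S" by (rule rev_image_eqI) (simp add: split)
  qed
qed

lemma sum_permutations_split:
  fixes F :: "'a::linorder list \<Rightarrow> 'b::comm_monoid_add"
  assumes "finite A" "m \<in> A"
  shows "(\<Sum>p\<in>permutations_of_set A. F p)
    = (\<Sum>B\<in>Pow (A - {m}). \<Sum>xs\<in>permutations_of_set B.
         \<Sum>ys\<in>permutations_of_set (A - {m} - B). F (xs @ m # ys))"
proof -
  have "(\<Sum>p\<in>permutations_of_set A. F p)
    = (\<Sum>(B, xs, ys)\<in>(SIGMA B : Pow (A - {m}).
         permutations_of_set B \<times> permutations_of_set (A - {m} - B)). F (xs @ m # ys))"
    using sum.reindex_bij_betw[OF bij_betw_permutations_split[OF assms(2)], of F]
    by (simp add: case_prod_unfold)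
  also have "\<dots> = (\<Sum>B\<in>Pow (A - {m}).
      \<Sum>(xs, ys)\<in>permutations_of_set B \<times> permutations_of_set (A - {m} - B). F (xs @ m # ys))"
    using assms(1) by (subst sum.Sigma) (auto simp: case_prod_unfold intro: finite_subset)
  finally show ?thesis by (simp add: sum.cartesian_product)
qed

lemma sum_Pow_card:
  fixes g :: "nat \<Rightarrow> 'a::comm_semiring_1"
  assumes "finite C"
  shows "(\<Sum>B\<in>Pow C. g (card B)) = (\<Sum>j\<le>card C. of_nat (card C choose j) * g j)"
proof -
  have "(\<Sum>B\<in>Pow C. g (card B)) = (\<Sum>j\<le>card C. \<Sum>B\<in>{B\<in>Pow C. card B = j}. g (card B))"
    by (rule sum.group[symmetric]) (use assms in \<open>auto intro: card_mono\<close>)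
  also have "\<dots> = (\<Sum>j\<le>card C. of_nat (card C choose j) * g j)"
    using n_subsets[OF assms] by (intro sum.cong) auto
  finally show ?thesis .
qed

text \<open>The uniform split at the root: of the \<open>(n + 1)!\<close> permutations, exactly \<open>n!\<close> have \<open>j\<close> entries
  before the maximum, since \<open>(n choose j) j! (n - j)! = n!\<close>. The subtrees carry arbitrary label
  sets, so the averages \<open>a\<close> and \<open>b\<close> are assumed for every proper subset of \<open>A\<close>; as they depend
  only on its cardinality, no relabelling is needed in the inductions that use this lemma.\<close>

lemma sum_decreasing_trees_product:
  fixes g h :: "'a::linorder tree \<Rightarrow> real" and a b :: "nat \<Rightarrow> real"
  assumes A: "finite A" "card A = Suc n"
    and g: "\<And>B. B \<subset> A \<Longrightarrow>
      (\<Sum>p\<in>permutations_of_set B. g (decreasing_tree p)) = fact (card B) * a (card B)"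
    and h: "\<And>B. B \<subset> A \<Longrightarrow>
      (\<Sum>p\<in>permutations_of_set B. h (decreasing_tree p)) = fact (card B) * b (card B)"
  shows "(\<Sum>p\<in>permutations_of_set A. g (left (decreasing_tree p)) * h (right (decreasing_tree p)))
    = fact n * (\<Sum>j\<le>n. a j * b (n - j))"
proof -
  define m where "m = Max A"
  have "A \<noteq> {}" using A by auto
  then have m: "m \<in> A"
    unfolding m_def using A(1) by (rule Max_in[rotated])
  have less_m: "x < m" if "x \<in> A - {m}" for x
    using that Max_ge[OF A(1), of x] by (auto simp: m_def order.strict_iff_order)
  have C: "finite (A - {m})" "card (A - {m}) = n" using A m by auto
  have "(\<Sum>p\<in>permutations_of_set A. g (left (decreasing_tree p)) * h (right (decreasing_tree p)))
      = (\<Sum>B\<in>Pow (A - {m}). \<Sum>xs\<in>permutations_of_set B. \<Sum>ys\<in>permutations_of_set (A - {m} - B).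
           g (decreasing_tree xs) * h (decreasing_tree ys))"
    unfolding sum_permutations_split[OF A(1) m]
  proof (intro sum.cong refl)
    fix B xs ys
    assume "B \<in> Pow (A - {m})" "xs \<in> permutations_of_set B"
      "ys \<in> permutations_of_set (A - {m} - B)"
    then have "set xs \<union> set ys \<subseteq> A - {m}"
      by (auto dest: permutations_of_setD)
    then have "decreasing_tree (xs @ m # ys) = Node (decreasing_tree xs) m (decreasing_tree ys)"
      using less_m by (intro decreasing_tree_split) blast
    then show "g (left (decreasing_tree (xs @ m # ys))) * h (right (decreasing_tree (xs @ m # ys)))
        = g (decreasing_tree xs) * h (decreasing_tree ys)" by simp
  qed
  also have "\<dots> = (\<Sum>B\<in>Pow (A - {m}).
      fact (card B) * a (card B) * (fact (n - card B) * b (n - card B)))"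
  proof (intro sum.cong refl)
    fix B assume B: "B \<in> Pow (A - {m})"
    then have "B \<subset> A" "A - {m} - B \<subset> A" using m by auto
    moreover have "card (A - {m} - B) = n - card B"
      using B C by (metis PowD card_Diff_subset finite_subset)
    ultimately show "(\<Sum>xs\<in>permutations_of_set B. \<Sum>ys\<in>permutations_of_set (A - {m} - B).
           g (decreasing_tree xs) * h (decreasing_tree ys))
        = fact (card B) * a (card B) * (fact (n - card B) * b (n - card B))"
      using g h by (simp flip: sum_product)
  qed
  also have "\<dots> = (\<Sum>j\<le>n. real (n choose j) * (fact j * a j * (fact (n - j) * b (n - j))))"
    using sum_Pow_card[OF C(1), of "\<lambda>j. fact j * a j * (fact (n - j) * b (n - j))"] C(2) by simp
  also have "\<dots> = fact n * (\<Sum>j\<le>n. a j * b (n - j))"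
    unfolding sum_distrib_left
    by (intro sum.cong refl) (simp add: binomial_fact)
  finally show ?thesis .
qed

section \<open>Levels in decreasing trees\<close>

text \<open>Counting empty trees as deep makes the condition on a root a plain conjunction over both
  subtrees, without distinguishing vertices with one child from vertices with two. The single
  exception is a vertex without children.\<close>

definition deep :: "nat \<Rightarrow> 'a tree \<Rightarrow> bool" where
  "deep k t \<longleftrightarrow> t = Leaf \<or> k < level t"

lemma deep_0: "deep 0 t"
  by (simp add: deep_def level_def)

lemma deep_Suc_Node:
  "deep (Suc k) (Node l x r) \<longleftrightarrow> deep k l \<and> deep k r \<and> \<not> (l = Leaf \<and> r = Leaf)"
proof (cases "l = Leaf \<and> r = Leaf")
  case True
  then show ?thesis by (simp add: deep_def level_leaf)
next
  case False
  then have "deep (Suc k) (Node l x r) \<longleftrightarrow> k < Min (level ` ({l, r} - {Leaf}))"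
    by (simp add: deep_def level_Node)
  also have "\<dots> \<longleftrightarrow> (\<forall>t\<in>{l, r} - {Leaf}. k < level t)"
    using False by (subst Min_gr_iff) auto
  finally show ?thesis using False by (auto simp: deep_def)
qed

lemma decreasing_tree_eq_Leaf_iff: "decreasing_tree p = Leaf \<longleftrightarrow> p = []"
  by (subst eq_set_tree_empty[symmetric]) (simp add: set_tree_decreasing_tree del: eq_set_tree_empty)

text \<open>For at least two entries, a deep tree is a product of deep subtrees, and the convolution of the
  averages is a coefficient of the square of the generating function; integration supplies the
  factor \<open>1 / n\<close> that turns \<open>(n - 1)!\<close> into \<open>n!\<close>. The tree with a single vertex has two deep,
  empty subtrees but is not deep itself, which accounts for the summand \<open>-1\<close>.\<close>

lemma sum_deep:
  fixes A :: "'a::linorder set"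
  assumes "finite A"
  shows "(\<Sum>p\<in>permutations_of_set A. of_bool (deep k (decreasing_tree p)))
    = fact (card A) * deep_gf k $ card A"
  using assms
proof (induction k arbitrary: A)
  case 0
  then show ?case by (simp add: deep_0 geometric_def)
next
  case (Suc k)
  consider "card A = 0" | "card A = 1" | n where "card A = Suc (Suc n)"
    by (metis One_nat_def not0_implies_Suc)
  then show ?case
  proof cases
    case 1
    then have "A = {}" using Suc.prems by simp
    then show ?thesis by (simp add: deep_def decreasing_tree.simps)
  next
    case 2
    then obtain x where "A = {x}" by (auto simp: card_1_singleton_iff)
    moreover have "decreasing_tree [x] = Node Leaf x Leaf"
      by (simp add: decreasing_tree.simps)
    moreover have "deep_gf k $ 0 = 1"
      by (cases k) (simp_all add: geometric_def)
    ultimately show ?thesis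
      using fps_integral_nth_0_Suc(2)[of "(deep_gf k)\<^sup>2 - 1" 1 0]
      by (simp add: deep_Suc_Node power2_eq_square)
  next
    case (3 n)
    have "(\<Sum>p\<in>permutations_of_set A. of_bool (deep (Suc k) (decreasing_tree p)))
        = (\<Sum>p\<in>permutations_of_set A. of_bool (deep k (left (decreasing_tree p)))
            * of_bool (deep k (right (decreasing_tree p))) :: real)"
    proof (intro sum.cong refl)
      fix p assume "p \<in> permutations_of_set A"
      then have len: "length (inorder (decreasing_tree p)) = Suc (Suc n)"
        using 3 by (simp add: inorder_decreasing_tree length_finite_permutations_of_set)
      obtain l x r where "decreasing_tree p = Node l x r"
        using len by (cases "decreasing_tree p") auto
      then show "of_bool (deep (Suc k) (decreasing_tree p))
          = (of_bool (deep k (left (decreasing_tree p)))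
             * of_bool (deep k (right (decreasing_tree p))) :: real)"
        using len by (auto simp: deep_Suc_Node)
    qed
    also have "\<dots> = fact (Suc n) * (\<Sum>j\<le>Suc n. deep_gf k $ j * deep_gf k $ (Suc n - j))"
      using Suc 3 by (intro sum_decreasing_trees_product) (auto intro: finite_subset)
    also have "\<dots> = fact (Suc (Suc n)) * deep_gf (Suc k) $ Suc (Suc n)"
      by (simp add: power2_eq_square fps_mult_nth atMost_atLeast0 field_simps
               del: sum.atMost_Suc sum.atLeast0_atMost_Suc of_nat_Suc)
    finally show ?thesis using 3 by simp
  qed
qed

definition root_gf :: "nat \<Rightarrow> real fps" where
  "root_gf k = deep_gf k - deep_gf (Suc k)"

lemma root_gf_log_poly: "root_gf k \<in> log_polys 0"
  using log_polys_diff[OF deep_gf_diff_geometric[of k] deep_gf_diff_geometric[of "Suc k"]]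
  by (simp add: root_gf_def)

lemma sum_root_level:
  fixes A :: "'a::linorder set"
  assumes "finite A" "A \<noteq> {}"
  shows "(\<Sum>p\<in>permutations_of_set A. of_bool (level (decreasing_tree p) = Suc k))
    = fact (card A) * root_gf k $ card A"
proof -
  have "(\<Sum>p\<in>permutations_of_set A. of_bool (level (decreasing_tree p) = Suc k))
    = (\<Sum>p\<in>permutations_of_set A. of_bool (deep k (decreasing_tree p))
        - of_bool (deep (Suc k) (decreasing_tree p)) :: real)"
  proof (intro sum.cong refl)
    fix p assume "p \<in> permutations_of_set A"
    then have "decreasing_tree p \<noteq> Leaf"
      using assms(2) by (auto simp: decreasing_tree_eq_Leaf_iff dest: permutations_of_setD)
    then show "of_bool (level (decreasing_tree p) = Suc k)
        = (of_bool (deep k (decreasing_tree p)) - of_bool (deep (Suc k) (decreasing_tree p)) :: real)"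
      by (auto simp: deep_def)
  qed
  then show ?thesis
    by (simp only: sum_subtractf sum_deep[OF assms(1)] root_gf_def fps_sub_nth right_diff_distrib)
qed

lemma finite_subtrees: "finite (subtrees t)"
  by (induction t) auto

text \<open>Vertices are represented by their subtrees, so a nonempty subtree occurring on both sides would
  be counted once instead of twice. Disjoint label sets exclude this.\<close>

lemma card_vertices_at_level_Node:
  assumes "set_tree l \<inter> set_tree r = {}"
  shows "card (vertices_at_level k (Node l x r))
    = of_bool (level (Node l x r) = k) + card (vertices_at_level k l) + card (vertices_at_level k r)"
proof -
  let ?V = "vertices_at_level k" and ?t = "Node l x r"
  let ?root = "if level ?t = k then {?t} else {}"
  have fin: "finite (?V t)" for t :: "'a tree"
    by (simp add: vertices_at_level_def finite_subtrees)
  have "?V ?t = ?root \<union> (?V l \<union> ?V r)"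
    by (auto simp: vertices_at_level_def)
  moreover have "?t \<notin> ?V l \<union> ?V r"
    by (auto simp: vertices_at_level_def dest: size_subtrees)
  moreover have "?V l \<inter> ?V r = {}"
  proof (rule ccontr)
    assume "?V l \<inter> ?V r \<noteq> {}"
    then obtain s where s: "s \<in> subtrees l" "s \<in> subtrees r" "s \<noteq> Leaf"
      by (auto simp: vertices_at_level_def)
    then obtain l' y r' where "s = Node l' y r'" by (cases s) auto
    with s assms show False by (auto dest: in_set_tree_if)
  qed
  ultimately show ?thesis
    using fin by (auto simp: card_Un_disjoint)
qed

section \<open>The expected number of vertices at a level\<close>

text \<open>The closed form of the solution of the quicksort recurrence with toll \<open>p\<close>, provided that
  \<open>p 0 = 0\<close> when the recurrence is started from \<open>0\<close>.\<close>

definition toll_sum :: "(nat \<Rightarrow> real) \<Rightarrow> nat \<Rightarrow> real" where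
  "toll_sum p n = p n + 2 * real (n + 1) * (\<Sum>i<n. p i / (real (i + 1) * real (i + 2)))"

text \<open>The weights \<open>1 / ((i + 1) (i + 2))\<close> are chosen such that the partial sums of the solution are
  again a multiple of the same weighted sum, which makes the recurrence immediate.\<close>

lemma sum_toll_sum:
  "(\<Sum>j<n. toll_sum p j) = real n * real (n + 1) * (\<Sum>i<n. p i / (real (i + 1) * real (i + 2)))"
proof (induction n)
  case (Suc n)
  define s where "s = (\<Sum>i<n. p i / (real (i + 1) * real (i + 2)))"
  have "(\<Sum>j<Suc n. toll_sum p j) = real (n + 1) * real (n + 2) * s + p n"
    unfolding sum.lessThan_Suc Suc.IH unfolding toll_sum_def s_def[symmetric]
    by (simp add: algebra_simps)
  also have "\<dots> = real (n + 1) * real (n + 2) * (s + p n / (real (n + 1) * real (n + 2)))"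
  proof -
    have "real (n + 1) * real (n + 2) \<noteq> 0"
      by (simp del: of_nat_add)
    moreover have "N * x + y = N * (x + y / N)" if "N \<noteq> 0" for N x y :: real
      using that by (simp add: field_simps)
    ultimately show ?thesis by blast
  qed
  finally show ?case
    by (simp add: s_def)
qed simp

lemma toll_sum_recurrence:
  "toll_sum p (Suc n) = p (Suc n) + 2 / real (Suc n) * (\<Sum>j\<le>n. toll_sum p j)"
  unfolding lessThan_Suc_atMost[symmetric] sum_toll_sum
  by (simp add: toll_sum_def field_simps del: sum.lessThan_Suc)

text \<open>The vertices at a level are the root, if it is at that level, and those of the two subtrees.
  Averaging over all permutations, each subtree contributes the same amount by symmetry, which
  gives the factor \<open>2\<close> in the recurrence.\<close>

lemma sum_vertices_at_level:
  fixes A :: "'a::linorder set"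
  assumes "finite A"
  shows "(\<Sum>p\<in>permutations_of_set A. real (card (vertices_at_level (Suc k) (decreasing_tree p))))
    = fact (card A) * toll_sum (fps_nth (root_gf k)) (card A)"
  using assms
proof (induction A rule: finite_psubset_induct)
  case (psubset A)
  let ?e = "toll_sum (fps_nth (root_gf k))"
  let ?v = "\<lambda>t :: 'a tree. real (card (vertices_at_level (Suc k) t))"
  show ?case
  proof (cases "card A")
    case 0
    have "deep_gf j $ 0 = 1" for j
      by (cases j) (simp_all add: geometric_def)
    then have "root_gf k $ 0 = 0"
      by (simp add: root_gf_def)
    moreover have "A = {}" using 0 psubset.hyps by simp
    ultimately show ?thesis
      by (simp add: decreasing_tree.simps vertices_at_level_def toll_sum_def)
  next
    case (Suc n)
    have "A \<noteq> {}" using Suc by auto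
    have one: "(\<Sum>p\<in>permutations_of_set B. 1) = fact (card B) * (1 :: real)" if "B \<subset> A" for B
    proof -
      have "finite B" using that psubset.hyps finite_subset by blast
      then show ?thesis by simp
    qed
    have IH: "(\<Sum>p\<in>permutations_of_set B. ?v (decreasing_tree p)) = fact (card B) * ?e (card B)"
      if "B \<subset> A" for B
      using psubset.IH that by blast
    have "(\<Sum>p\<in>permutations_of_set A. ?v (decreasing_tree p))
        = (\<Sum>p\<in>permutations_of_set A. of_bool (level (decreasing_tree p) = Suc k)
            + ?v (left (decreasing_tree p)) * 1 + 1 * ?v (right (decreasing_tree p)))"
    proof (intro sum.cong refl)
      fix p assume p: "p \<in> permutations_of_set A"
      then have "decreasing_tree p \<noteq> Leaf"
        using Suc by (auto simp: decreasing_tree_eq_Leaf_iff dest: permutations_of_setD)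
      then obtain l x r where t: "decreasing_tree p = Node l x r"
        by (cases "decreasing_tree p") auto
      have "distinct (inorder (decreasing_tree p))"
        using p by (simp add: inorder_decreasing_tree permutations_of_setD)
      then have "set_tree l \<inter> set_tree r = {}"
        by (auto simp: t)
      then show "?v (decreasing_tree p) = of_bool (level (decreasing_tree p) = Suc k)
            + ?v (left (decreasing_tree p)) * 1 + 1 * ?v (right (decreasing_tree p))"
        by (simp add: t card_vertices_at_level_Node)
    qed
    also have "\<dots> = fact (card A) * root_gf k $ card A
        + fact n * (\<Sum>j\<le>n. ?e j * 1) + fact n * (\<Sum>j\<le>n. 1 * ?e (n - j))"
      using sum_root_level[OF psubset.hyps \<open>A \<noteq> {}\<close>, of k]
        sum_decreasing_trees_product[OF psubset.hyps Suc, of ?v ?e "\<lambda>_. 1" "\<lambda>_. 1", OF IH one]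
        sum_decreasing_trees_product[OF psubset.hyps Suc, of "\<lambda>_. 1" "\<lambda>_. 1" ?v ?e, OF one IH]
      by (simp only: sum.distrib)
    also have "(\<Sum>j\<le>n. 1 * ?e (n - j)) = (\<Sum>j\<le>n. ?e j)"
      using sum.nat_diff_reindex[of ?e "Suc n"] by (simp add: lessThan_Suc_atMost)
    finally show ?thesis
      by (simp add: Suc toll_sum_recurrence field_simps)
  qed
qed

theorem theorem4p3:
  fixes k :: nat
  assumes "k \<ge> 1"
  shows "\<exists>c::rat. (\<lambda>n. real (total_at_level n k) / fact (n + 1)) \<longlonglongrightarrow> of_rat c"
proof -
  obtain k' where k: "k = Suc k'" using assms by (cases k) auto
  let ?p = "fps_nth (root_gf k')"
  let ?s = "\<lambda>n. \<Sum>i<n. ?p i / (real (i + 1) * real (i + 2))"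
  have ratio: "real (total_at_level n k) / fact (n + 1) = ?p n * inverse (real (Suc n)) + 2 * ?s n" for n
  proof -
    have "real (total_at_level n k) = fact n * toll_sum ?p n"
      using sum_vertices_at_level[of "{1..n}" k'] by (simp add: total_at_level_def k)
    then have "real (total_at_level n k) = fact n * (?p n + 2 * real (n + 1) * ?s n)"
      by (simp only: toll_sum_def)
    then have "real (total_at_level n k) / fact (n + 1) = (?p n + 2 * real (n + 1) * ?s n) / real (n + 1)"
      by simp
    also have "\<dots> = ?p n * inverse (real (Suc n)) + 2 * ?s n"
    proof -
      have "(x + 2 * N * y) / N = x * inverse N + 2 * y" if "N \<noteq> 0" for x y N :: real
        using that by (simp add: field_simps)
      from this[of "real (n + 1)"] show ?thesis by (simp only: Suc_eq_plus1 of_nat_eq_0_iff)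
    qed
    finally show ?thesis .
  qed
  obtain c where c: "c \<in> \<rat>" "?s \<longlonglongrightarrow> c"
    using log_polys_weighted_sum_rational[OF root_gf_log_poly[of k']] by (auto simp: sums_def)
  have "(\<lambda>n. ?p n * inverse (real (Suc n)) + 2 * ?s n) \<longlonglongrightarrow> 0 * 0 + 2 * c"
    by (intro tendsto_intros c log_polys_coeff_tendsto_zero[OF root_gf_log_poly] LIMSEQ_inverse_real_of_nat)
  then have "(\<lambda>n. real (total_at_level n k) / fact (n + 1)) \<longlonglongrightarrow> 2 * c"
    by (simp only: ratio mult_zero_left add_0_left)
  moreover obtain q where "c = of_rat q" using c(1) by (auto elim: Rats_cases)
  ultimately show ?thesis
    by (intro exI[of _ "2 * q"]) (simp add: of_rat_mult)
qed

end
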